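(* For every integer $k\ge 3$, of either parity, there exists a $k$-reflective projective billiard in the plane; in particular one exists for every odd $k\ge 5$.
   Context: A projective billiard is a bounded domain $\Omega\subset\mathbb{R}^2$ together with a transversal line field assigning to each $p\in\partial\Omega$ (for a polygon: each $p$ interior to a side) a line $L(p)$ through $p$ not tangent to $\partial\Omega$. A ray arriving at $p$ is reflected into the ray such that the four lines (incoming line, outgoing line; tangent line, transversal line $L(p)$) through $p$ have cross ratio $-1$. All billiards considered have a polygonal domain with central fields: on each side of the polygon the transversal lines belong to the pencil through one fixed point (the centre of that side) lying off the line supporting the side. An orbit is the sequence of successive impact points $p_1,p_2,\dots$ of a billiard trajectory in $\Omega$; it is $k$-periodic if the trajectory returns after $k$ reflections to the same point with the same oriented direction. $\Omega$ is $k$-reflective if there are a $k$-periodic orbit $(p_1,\dots,p_k)$ and an open set $U_1\times U_2\subset(\partial\Omega)^2$ containing $(p_1,p_2)$ such that every $(q_1,q_2)\in U_1\times U_2$ begins a $k$-periodic orbit. *)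

theory Defs
  imports "HOL-Analysis.Analysis"
begin

text \<open>
  A polygon with \<open>n\<close> vertices is given by \<open>v 0, ..., v (n - 1)\<close> in cyclic order; its \<open>i\<close>-th side
  joins \<open>v i\<close> to \<open>v (i + 1)\<close>, the index being taken modulo \<open>n\<close>.
  Values of \<open>v\<close> beyond \<open>n - 1\<close> are irrelevant.
\<close>

definition side :: "nat \<Rightarrow> (nat \<Rightarrow> real^2) \<Rightarrow> nat \<Rightarrow> (real^2) set" where
  "side n v i = closed_segment (v i) (v (Suc i mod n))"

definition side_interior :: "nat \<Rightarrow> (nat \<Rightarrow> real^2) \<Rightarrow> nat \<Rightarrow> (real^2) set" where
  "side_interior n v i = open_segment (v i) (v (Suc i mod n))"

definition side_line :: "nat \<Rightarrow> (nat \<Rightarrow> real^2) \<Rightarrow> nat \<Rightarrow> (real^2) set" where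
  "side_line n v i = affine hull {v i, v (Suc i mod n)}"

text \<open>
  Distinct sides meet in common vertices only. Convexity is not required, but flat vertices are
  excluded, so that a single straight side cannot be subdivided and carry several centres.
\<close>

definition simple_polygon :: "nat \<Rightarrow> (nat \<Rightarrow> real^2) \<Rightarrow> bool" where
  "simple_polygon n v \<longleftrightarrow>
     n \<ge> 3 \<and> inj_on v {..<n} \<and>
     (\<forall>i<n. \<not> collinear {v i, v (Suc i mod n), v (Suc (Suc i) mod n)}) \<and>
     (\<forall>i<n. \<forall>j<n. i \<noteq> j \<longrightarrow>
        side n v i \<inter> side n v j = {v i, v (Suc i mod n)} \<inter> {v j, v (Suc j mod n)})"

definition polygon_domain :: "nat \<Rightarrow> (nat \<Rightarrow> real^2) \<Rightarrow> (real^2) set" where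
  "polygon_domain n v = inside (\<Union>i<n. side n v i)"

text \<open>
  \<open>c i\<close> is the centre of the \<open>i\<close>-th side: the transversal line at a point \<open>p\<close> interior to that side
  is the line through \<open>p\<close> and \<open>c i\<close>, with direction \<open>c i - p\<close>.
\<close>

definition projective_billiard :: "nat \<Rightarrow> (nat \<Rightarrow> real^2) \<Rightarrow> (nat \<Rightarrow> real^2) \<Rightarrow> bool" where
  "projective_billiard n v c \<longleftrightarrow>
     simple_polygon n v \<and> (\<forall>i<n. c i \<notin> side_line n v i)"

definition cross2 :: "real^2 \<Rightarrow> real^2 \<Rightarrow> real" where
  "cross2 a b = a $ 1 * b $ 2 - a $ 2 * b $ 1"

text \<open>
  The cross ratio \<open>(a, b; t, l)\<close> of four concurrent lines, each given by a nonzero direction vector.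
  It does not change when one of the vectors is rescaled.
\<close>

definition cross_ratio :: "real^2 \<Rightarrow> real^2 \<Rightarrow> real^2 \<Rightarrow> real^2 \<Rightarrow> real" where
  "cross_ratio a b t l = (cross2 a t * cross2 b l) / (cross2 a l * cross2 b t)"

text \<open>
  Incoming direction \<open>a\<close>, outgoing direction \<open>b\<close>, tangent direction \<open>t\<close>, transversal direction \<open>l\<close>.
  The second disjunct is the usual degenerate case of harmonic conjugacy, in which the quotient
  above is undefined: a ray arriving along the transversal line is sent back along it.
\<close>

definition projective_reflection :: "real^2 \<Rightarrow> real^2 \<Rightarrow> real^2 \<Rightarrow> real^2 \<Rightarrow> bool" where
  "projective_reflection a b t l \<longleftrightarrow>
     cross_ratio a b t l = -1 \<or> (cross2 a l = 0 \<and> cross2 b l = 0)"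

text \<open>
  The reflection law determines the outgoing line; which of its two rays is followed is fixed by
  the requirement that consecutive impact points are joined through the domain.
\<close>

definition billiard_orbit ::
    "nat \<Rightarrow> (nat \<Rightarrow> real^2) \<Rightarrow> (nat \<Rightarrow> real^2) \<Rightarrow> (nat \<Rightarrow> real^2) \<Rightarrow> bool" where
  "billiard_orbit n v c p \<longleftrightarrow>
     (\<forall>m. \<exists>i<n. p m \<in> side_interior n v i) \<and>
     (\<forall>m. p m \<noteq> p (Suc m) \<and> open_segment (p m) (p (Suc m)) \<subseteq> polygon_domain n v) \<and>
     (\<forall>m. \<forall>i<n. p (Suc m) \<in> side_interior n v i \<longrightarrow>
        projective_reflection (p (Suc m) - p m) (p (Suc (Suc m)) - p (Suc m))
          (v (Suc i mod n) - v i) (c i - p (Suc m)))"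

text \<open>
  Impact points are numbered from 0. The period \<open>k\<close> need not be
  minimal.
\<close>

definition periodic_orbit ::
    "nat \<Rightarrow> (nat \<Rightarrow> real^2) \<Rightarrow> (nat \<Rightarrow> real^2) \<Rightarrow> nat \<Rightarrow> (nat \<Rightarrow> real^2) \<Rightarrow> bool" where
  "periodic_orbit n v c k p \<longleftrightarrow>
     billiard_orbit n v c p \<and> p k = p 0 \<and>
     (\<exists>s>0. p (Suc k) - p k = s *\<^sub>R (p 1 - p 0))"

definition reflective :: "nat \<Rightarrow> (nat \<Rightarrow> real^2) \<Rightarrow> (nat \<Rightarrow> real^2) \<Rightarrow> nat \<Rightarrow> bool" where
  "reflective n v c k \<longleftrightarrow>
     (\<exists>p U1 U2.
        periodic_orbit n v c k p \<and>
        openin (top_of_set (frontier (polygon_domain n v))) U1 \<and>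
        openin (top_of_set (frontier (polygon_domain n v))) U2 \<and>
        p 0 \<in> U1 \<and> p 1 \<in> U2 \<and>
        (\<forall>q1\<in>U1. \<forall>q2\<in>U2. \<exists>r. periodic_orbit n v c k r \<and> r 0 = q1 \<and> r 1 = q2))"

end

theory Submission imports Defs begin

text \<open>
  Reflection at a side with a centre is the restriction to lines of a single projective involution of
  the plane, the harmonic homology whose axis supports the side and whose centre is the centre of
  the side. A billiard with central fields is therefore \<open>k\<close>-reflective once a product of \<open>k\<close> such
  homologies is the identity and the resulting closed trajectories really bounce inside the polygon.
  Relations of this kind already occur in one triangle, with vertices \<open>(0, 0)\<close>, \<open>(1, 0)\<close> and
  \<open>(0, 1)\<close>; only the three centres change.

  A line that avoids the origin has a unique equation \<open>(1 + U) x + (1 + W) y = 1\<close>. The form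
  \<open>(1 + U) x + (1 + W) y - 1\<close> takes the values \<open>-1\<close>, \<open>U\<close>, \<open>W\<close> at the vertices, so signs of \<open>U\<close> and
  \<open>W\<close> tell which sides the line crosses, and the three reflections become affine maps of
  \<open>(U, W)\<close>: one leg keeps \<open>U\<close>, the other keeps \<open>W\<close>, and the hypotenuse with the origin as centre is
  \<open>(U, W) \<mapsto> (-U, -W)\<close>. Lemma \<open>billiard_orbit_crossings\<close> turns a sequence of lines related by these
  maps into a billiard orbit.

  Odd periods \<open>N + 1\<close>, with \<open>N\<close> even: put the centres of the legs on the hypotenuse line in such a
  way that the leg reflections are \<open>W' = 2 cos \<theta> U - W\<close> and \<open>U' = 2 cos \<theta> W - U\<close>, \<open>\<theta> = \<pi> / N\<close>.
  While the trajectory alternates between the legs, the successive coordinates form a sequence \<open>y\<close>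
  with \<open>y (r + 2) = 2 cos \<theta> y (r + 1) - y r\<close>, a combination of sines. If the trajectory comes from
  the hypotenuse, then \<open>y 0 < 0 < y 1\<close>; the sequence stays positive for exactly \<open>N\<close> steps and
  \<open>y (r + N) = - y r\<close>. Hence after \<open>N\<close> reflections at the legs the trajectory hits the
  hypotenuse along the line \<open>- (U, W)\<close>, and the reflection there restores \<open>(U, W)\<close>. In terms
  of groups, the half turn of the dihedral group of order \<open>2 N\<close> composed with the reflection in
  the plane orthogonal to its axis is \<open>-1\<close>, which is trivial projectively.

  Period \<open>4\<close>: when the centre of each leg is the midpoint of the other one, the leg reflections
  are \<open>W' = 2 - W\<close> and \<open>U' = 2 - U\<close>; they commute, and trajectories with \<open>0 < U, W < 2\<close> go back and
  forth between the legs.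

  Every \<open>k \<ge> 3\<close> is divisible by \<open>4\<close> or by an odd number that is at least \<open>3\<close>, and a closed
  trajectory may be traversed several times.
\<close>

section \<open>The triangle and its domain\<close>

text \<open>
  Side 0 is the leg on the first coordinate axis, side 1 the hypotenuse and side 2 the leg on the
  second axis.
\<close>

definition tri :: "nat \<Rightarrow> real^2" where
  "tri i = (if i = 1 then vector [1, 0] else if i = 2 then vector [0, 1] else 0)"

text \<open>
  The barycentric coordinates, numbered so that \<open>bary i\<close> vanishes on side \<open>i\<close> and equals 1 at the
  opposite vertex.
\<close>

definition bary :: "nat \<Rightarrow> real^2 \<Rightarrow> real" where
  "bary i x = (if i = 0 then x $ 2 else if i = 1 then 1 - x $ 1 - x $ 2 else x $ 1)"

lemma vec2_eq_iff: "(x :: real^2) = y \<longleftrightarrow> x $ 1 = y $ 1 \<and> x $ 2 = y $ 2"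
  by (simp add: vec_eq_iff forall_2)

lemma less_3_cases: "i < 3 \<Longrightarrow> i = 0 \<or> i = 1 \<or> i = (2::nat)"
  by auto

lemma all_less_3: "(\<forall>i<3. P i) \<longleftrightarrow> P 0 \<and> P 1 \<and> P (2::nat)"
  by (simp add: numeral_3_eq_3 numeral_2_eq_2 All_less_Suc conj_ac)

lemma tri_nth [simp]:
  "tri 0 = 0" "tri (Suc 0) $ 1 = 1" "tri (Suc 0) $ 2 = 0" "tri 2 $ 1 = 0" "tri 2 $ 2 = 1"
  by (simp_all add: tri_def)

lemma Suc_Suc_0: "Suc (Suc 0) = 2"
  by simp

text \<open>
  Along a side, the position of a point is read off from the two other barycentric
  coordinates; the descriptions of the closed and the open sides below are two instances of this.
\<close>

lemma side_param_tri:
  assumes "i < 3"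
  shows "x = (1 - u) *\<^sub>R tri i + u *\<^sub>R tri (Suc i mod 3) \<longleftrightarrow>
    bary i x = 0 \<and> bary (Suc i mod 3) x = 1 - u \<and> bary (Suc (Suc i) mod 3) x = u"
  using less_3_cases[OF assms] by (elim disjE) (auto simp: vec2_eq_iff bary_def Suc_Suc_0)

lemma bary_sum: "bary 0 x + bary 1 x + bary 2 x = 1"
  by (simp add: bary_def)

lemma side_tri:
  assumes "i < 3"
  shows "side 3 tri i = {x. bary i x = 0 \<and> (\<forall>j<3. 0 \<le> bary j x)}"
proof -
  have "x \<in> side 3 tri i \<longleftrightarrow> bary i x = 0 \<and> (\<forall>j<3. 0 \<le> bary j x)" for x
    unfolding side_def in_segment side_param_tri[OF assms]
    using less_3_cases[OF assms] bary_sum[of x]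
    by (elim disjE) (auto simp: all_less_3 Suc_Suc_0)
  then show ?thesis by blast
qed

lemma side_interior_tri:
  assumes "i < 3"
  shows "side_interior 3 tri i = {x. bary i x = 0 \<and> (\<forall>j<3. j \<noteq> i \<longrightarrow> 0 < bary j x)}"
proof -
  have "tri i \<noteq> tri (Suc i mod 3)"
    using less_3_cases[OF assms] by (elim disjE) (auto simp: vec2_eq_iff Suc_Suc_0)
  then have "x \<in> side_interior 3 tri i \<longleftrightarrow> bary i x = 0 \<and> (\<forall>j<3. j \<noteq> i \<longrightarrow> 0 < bary j x)" for x
    unfolding side_interior_def in_segment side_param_tri[OF assms]
    using less_3_cases[OF assms] bary_sum[of x]
    by (elim disjE) (auto simp: all_less_3 Suc_Suc_0)
  then show ?thesis by blast
qed

lemma side_line_tri: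
  assumes "i < 3"
  shows "side_line 3 tri i \<subseteq> {x. bary i x = 0}"
  using less_3_cases[OF assms]
  by (elim disjE) (auto simp: side_line_def affine_hull_2 bary_def Suc_Suc_0)

lemma simple_polygon_tri: "simple_polygon 3 tri"
proof -
  have "inj_on tri {..<3}"
    by (auto simp: inj_on_def vec2_eq_iff tri_def less_Suc_eq numeral_3_eq_3)
  moreover have "\<not> collinear {tri i, tri (Suc i mod 3), tri (Suc (Suc i) mod 3)}" if "i < 3" for i
  proof -
    have *: "\<not> collinear {tri 0, tri 1, tri 2}"
      by (auto simp: collinear_3_expand vec2_eq_iff)
    show ?thesis
      using less_3_cases[OF that] *
      by (elim disjE) (auto simp: insert_commute Suc_Suc_0)
  qed
  moreover have "side 3 tri i \<inter> side 3 tri j =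
      {tri i, tri (Suc i mod 3)} \<inter> {tri j, tri (Suc j mod 3)}" if "i < 3" "j < 3" "i \<noteq> j" for i j
    using less_3_cases[OF that(1)] less_3_cases[OF that(2)] that(3)
    by (elim disjE) (auto simp: side_tri all_less_3 bary_def vec2_eq_iff Suc_Suc_0)
  ultimately show ?thesis
    by (simp add: simple_polygon_def)
qed

lemma tri_boundary: "(\<Union>i<3. side 3 tri i) = {x. (\<forall>j<3. 0 \<le> bary j x) \<and> (\<exists>j<3. bary j x = 0)}"
  by (auto simp: side_tri)

definition closed_tri :: "(real^2) set" where
  "closed_tri = {x. \<forall>j<3. 0 \<le> bary j x}"

lemma bary_affine: "bary i ((1 - t) *\<^sub>R x + t *\<^sub>R y) = (1 - t) * bary i x + t * bary i y"
  by (simp add: bary_def algebra_simps)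

text \<open>
  In this form the topological facts about half-spaces give convexity, closedness and the interior.
\<close>

lemma closed_tri_halfspaces:
  "closed_tri = {x. (vector [-1, 0] :: real^2) \<bullet> x \<le> 0} \<inter> {x. (vector [0, -1] :: real^2) \<bullet> x \<le> 0}
     \<inter> {x. (vector [1, 1] :: real^2) \<bullet> x \<le> 1}"
  by (auto simp: closed_tri_def bary_def all_less_3 inner_vec_def sum_2)

lemma convex_closed_tri: "convex closed_tri"
  unfolding closed_tri_halfspaces by (intro convex_Int convex_halfspace_le)

lemma closed_closed_tri: "closed closed_tri"
  unfolding closed_tri_halfspaces by (intro closed_Int closed_halfspace_le)

lemma interior_closed_tri: "interior closed_tri = {x. \<forall>j<3. 0 < bary j x}"
proof -
  have "(vector [-1, 0] :: real^2) \<noteq> 0" "(vector [0, -1] :: real^2) \<noteq> 0" "(vector [1, 1] :: real^2) \<noteq> 0"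
    by (auto simp: vec2_eq_iff)
  then show ?thesis
    unfolding closed_tri_halfspaces interior_Int
    by (simp only: interior_halfspace_le not_False_eq_True) (auto simp: bary_def all_less_3 inner_vec_def sum_2)
qed

lemma bounded_closed_tri: "bounded closed_tri"
proof -
  have "norm x \<le> 2" if "x \<in> closed_tri" for x
    using norm_le_l1_cart[of x] that by (auto simp: closed_tri_def bary_def all_less_3 sum_2)
  then show ?thesis
    by (auto simp: bounded_iff)
qed

lemma frontier_closed_tri: "frontier closed_tri = (\<Union>i<3. side 3 tri i)"
  unfolding frontier_def interior_closed_tri tri_boundary
  using closure_closed[OF closed_closed_tri]
  by (force simp: closed_tri_def order.order_iff_strict)

text \<open>
  The sides form the frontier of a bounded convex set, and the inside of such a frontier is the
  interior of the set.
\<close>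

lemma polygon_domain_tri: "polygon_domain 3 tri = {x. \<forall>j<3. 0 < bary j x}"
  unfolding polygon_domain_def frontier_closed_tri[symmetric] interior_closed_tri[symmetric]
  by (intro inside_frontier_eq_interior bounded_closed_tri convex_closed_tri)

lemma frontier_domain_tri: "frontier (polygon_domain 3 tri) = (\<Union>i<3. side 3 tri i)"
proof -
  have "vector [1/3, 1/3] \<in> interior closed_tri"
    by (simp add: interior_closed_tri bary_def all_less_3)
  then have "closure (interior closed_tri) = closed_tri"
    using convex_closure_interior[OF convex_closed_tri] closed_closed_tri by auto
  then have "frontier (interior closed_tri) = frontier closed_tri"
    by (simp add: frontier_def closed_closed_tri)
  then show ?thesis
    by (simp add: polygon_domain_tri interior_closed_tri frontier_closed_tri)
qed

text \<open>
  The neighbourhoods in the definition of reflectivity are taken to be open sides or parts of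
  them.
\<close>

lemma side_interior_openin:
  assumes "i < 3"
  shows "openin (top_of_set (frontier (polygon_domain 3 tri))) (side_interior 3 tri i)"
proof -
  have "open {x. bary j x > 0}" for j
    unfolding bary_def by (cases "j = 0"; cases "j = 1") (auto intro!: open_Collect_less continuous_intros)
  then have "open (\<Inter>j\<in>{..<3} - {i}. {x. bary j x > 0})"
    by (intro open_INT) auto
  moreover have "side_interior 3 tri i =
      frontier (polygon_domain 3 tri) \<inter> (\<Inter>j\<in>{..<3} - {i}. {x. bary j x > 0})"
  proof (intro set_eqI iffI)
    fix x assume "x \<in> side_interior 3 tri i"
    then show "x \<in> frontier (polygon_domain 3 tri) \<inter> (\<Inter>j\<in>{..<3} - {i}. {x. bary j x > 0})"
      using assms unfolding frontier_domain_tri tri_boundary side_interior_tri[OF assms]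
      by (auto intro: less_imp_le)
  next
    fix x assume x: "x \<in> frontier (polygon_domain 3 tri) \<inter> (\<Inter>j\<in>{..<3} - {i}. {x. bary j x > 0})"
    then obtain l where "l < 3" "bary l x = 0"
      unfolding frontier_domain_tri tri_boundary by auto
    moreover have pos: "0 < bary j x" if "j < 3" "j \<noteq> i" for j
      using x that by auto
    ultimately have "bary i x = 0"
      by (cases "l = i") fastforce+
    with pos show "x \<in> side_interior 3 tri i"
      by (simp add: side_interior_tri[OF assms])
  qed
  ultimately show ?thesis
    by (simp add: openin_open_Int)
qed

lemma open_segment_in_domain:
  assumes "x \<in> side_interior 3 tri i" "y \<in> side_interior 3 tri j" "i < 3" "j < 3" "i \<noteq> j"
  shows "open_segment x y \<subseteq> polygon_domain 3 tri"
proof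
  fix z assume "z \<in> open_segment x y"
  then obtain t where t: "0 < t" "t < 1" "z = (1 - t) *\<^sub>R x + t *\<^sub>R y"
    by (auto simp: in_segment)
  have "0 < bary l z" if "l < 3" for l
  proof (cases "l = i")
    case True
    then show ?thesis using assms t by (simp add: side_interior_tri bary_affine)
  next
    case False
    then have "0 < bary l x" "0 \<le> bary l y"
      using assms that by (auto simp: side_interior_tri order.order_iff_strict)
    then show ?thesis
      using t by (simp add: bary_affine add_pos_nonneg)
  qed
  then show "z \<in> polygon_domain 3 tri"
    by (simp add: polygon_domain_tri)
qed

lemma side_interior_tri_disjoint:
  assumes "x \<in> side_interior 3 tri i" "x \<in> side_interior 3 tri j" "i < 3" "j < 3"
  shows "i = j"
proof (rule ccontr)
  assume "i \<noteq> j"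
  then have "0 < bary j x"
    using assms(1,3,4) by (auto simp: side_interior_tri)
  moreover have "bary j x = 0"
    using assms(2,4) by (auto simp: side_interior_tri)
  ultimately show False by simp
qed

section \<open>Lines in dual coordinates\<close>

text \<open>
  Whether the line with coordinates \<open>U\<close>, \<open>W\<close> separates the endpoints of side \<open>i\<close>, at which its
  affine form takes two of the values \<open>-1\<close>, \<open>U\<close>, \<open>W\<close>.
\<close>

definition crosses :: "real \<Rightarrow> real \<Rightarrow> nat \<Rightarrow> bool" where
  "crosses U W i \<longleftrightarrow> (if i = 0 then 0 < U else if i = 1 then U * W < 0 else 0 < W)"

definition crossing :: "real \<Rightarrow> real \<Rightarrow> nat \<Rightarrow> real^2" where
  "crossing U W i = (if i = 0 then vector [1 / (1 + U), 0]
     else if i = 1 then vector [W / (W - U), - U / (W - U)] else vector [0, 1 / (1 + W)])"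

definition covec :: "real \<Rightarrow> real \<Rightarrow> real^2" where
  "covec U W = vector [1 + U, 1 + W]"

lemma inner_covec: "covec U W \<bullet> x = (1 + U) * x $ 1 + (1 + W) * x $ 2"
  by (simp add: covec_def inner_vec_def sum_2)

lemma crossing_in_side_interior:
  assumes "crosses U W i" "i < 3"
  shows "crossing U W i \<in> side_interior 3 tri i"
  using less_3_cases[OF assms(2)] assms(1)
  by (elim disjE)
    (auto simp: side_interior_tri crosses_def crossing_def bary_def all_less_3 mult_less_0_iff
      divide_simps)

lemma inner_covec_crossing:
  assumes "crosses U W i" "i < 3"
  shows "covec U W \<bullet> crossing U W i = 1"
  using less_3_cases[OF assms(2)] assms(1)
  by (elim disjE)
    (auto simp: crosses_def crossing_def inner_covec mult_less_0_iff divide_simps, auto simp: algebra_simps)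

text \<open>
  A direction of the line \<open>g \<bullet> x = 1\<close> is a multiple of \<open>g\<close> rotated by a right angle, so \<open>cross2\<close>
  with it is a multiple of evaluating \<open>g\<close>. This turns the cross ratio of directions into an
  expression in the equations of the lines.
\<close>

lemma orthogonal_cross2:
  assumes "g \<bullet> d = 0" "g \<noteq> 0" "d \<noteq> (0 :: real^2)"
  obtains s where "s \<noteq> 0" "\<And>z. cross2 d z = s * (g \<bullet> z)"
proof -
  have gd: "g $ 1 * d $ 1 + g $ 2 * d $ 2 = 0"
    using assms(1) by (simp add: inner_vec_def sum_2)
  obtain s where s: "d $ 1 = s * g $ 2" "d $ 2 = - s * g $ 1"
  proof (cases "g $ 1 = 0")
    case True
    then have "g $ 2 \<noteq> 0" using assms(2) by (auto simp: vec2_eq_iff)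
    then show ?thesis using that[of "d $ 1 / g $ 2"] True gd by auto
  next
    case False
    then show ?thesis using that[of "- d $ 2 / g $ 1"] gd
      by (auto simp: field_simps)
  qed
  show ?thesis
  proof
    show "s \<noteq> 0" using s assms(3) by (auto simp: vec2_eq_iff)
    show "cross2 d z = s * (g \<bullet> z)" for z
      by (simp add: cross2_def s inner_vec_def sum_2 algebra_simps)
  qed
qed

lemma projective_reflection_covectors:
  assumes "g \<bullet> a = 0" "h \<bullet> b = 0" "g \<bullet> t \<noteq> 0" "h \<bullet> t \<noteq> 0" "a \<noteq> 0" "b \<noteq> 0"
    and harm: "(g \<bullet> t) * (h \<bullet> l) + (g \<bullet> l) * (h \<bullet> t) = 0"
  shows "projective_reflection a b t l"
proof -
  obtain r where r: "r \<noteq> 0" "\<And>z. cross2 a z = r * (g \<bullet> z)"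
    using orthogonal_cross2[of g a] assms by (metis inner_zero_left)
  obtain s where s: "s \<noteq> 0" "\<And>z. cross2 b z = s * (h \<bullet> z)"
    using orthogonal_cross2[of h b] assms by (metis inner_zero_left)
  show ?thesis
  proof (cases "g \<bullet> l = 0")
    case True
    with harm assms have "h \<bullet> l = 0" by auto
    with True show ?thesis by (simp add: projective_reflection_def r s)
  next
    case False
    then have "cross_ratio a b t l = -1"
      using harm assms r(1) s(1) by (simp add: cross_ratio_def r(2) s(2) field_simps)
    then show ?thesis by (simp add: projective_reflection_def)
  qed
qed

text \<open>
  The reflection law in dual coordinates. Lines through a common point of a leg share the coordinate
  that belongs to this leg, and harmonicity says that the values at the centre of the two affine
  forms are opposite. On the hypotenuse only the origin is considered as a centre.
\<close>

definition reflects :: "real^2 \<Rightarrow> nat \<Rightarrow> real \<Rightarrow> real \<Rightarrow> real \<Rightarrow> real \<Rightarrow> bool" where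
  "reflects c i U W U' W' \<longleftrightarrow>
     (if i = 0 then U' = U \<and> (covec U W \<bullet> c - 1) + (covec U' W' \<bullet> c - 1) = 0
      else if i = 1 then U' = - U \<and> W' = - W \<and> c = 0
      else W' = W \<and> (covec U W \<bullet> c - 1) + (covec U' W' \<bullet> c - 1) = 0)"

lemma reflects_crossing:
  assumes "reflects c i U W U' W'" "crosses U W i" "i < 3"
  shows "crossing U' W' i = crossing U W i"
  using less_3_cases[OF assms(3)] assms(1,2)
  by (elim disjE)
    (auto simp: reflects_def crossing_def crosses_def divide_simps vec2_eq_iff, auto simp: algebra_simps)

text \<open>
  Both affine forms vanish at the impact point \<open>p\<close>, so evaluating them at \<open>c - p\<close> gives their values
  at \<open>c\<close>. On a leg the two forms have the same slope along the side and opposite values at \<open>c\<close>; on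
  the hypotenuse they have opposite slopes and the same value \<open>-1\<close> at the origin. The cross ratio is
  \<open>-1\<close> in both cases.
\<close>

lemma reflects_projective_reflection:
  assumes refl: "reflects c i U W U' W'" and cross: "crosses U W i" "crosses U' W' i" "i < 3"
    and p: "p = crossing U W i" "covec U W \<bullet> a = 0" "covec U' W' \<bullet> b = 0" "a \<noteq> 0" "b \<noteq> 0"
  shows "projective_reflection a b (tri (Suc i mod 3) - tri i) (c - p)"
proof -
  let ?t = "tri (Suc i mod 3) - tri i"
  have on: "covec U W \<bullet> p = 1" "covec U' W' \<bullet> p = 1"
    using inner_covec_crossing[OF cross(1,3)] inner_covec_crossing[OF cross(2,3)]
      reflects_crossing[OF refl cross(1,3)] by (auto simp: p)
  have "covec U W \<bullet> ?t \<noteq> 0"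
    using less_3_cases[OF cross(3)] cross(1)
    by (elim disjE) (auto simp: crosses_def inner_covec mult_less_0_iff Suc_Suc_0)
  moreover have "covec U' W' \<bullet> ?t = covec U W \<bullet> ?t \<and> (covec U W \<bullet> c - 1) + (covec U' W' \<bullet> c - 1) = 0
      \<or> covec U' W' \<bullet> ?t = - (covec U W \<bullet> ?t) \<and> c = 0"
    using less_3_cases[OF cross(3)] refl
    by (elim disjE) (auto simp: reflects_def inner_covec Suc_Suc_0)
  moreover have "x * v + u * x = 0" if "u + v = 0" for x u v :: real
    using that by (metis add.commute distrib_left mult.commute mult_zero_right)
  ultimately have "covec U W \<bullet> ?t \<noteq> 0 \<and> covec U' W' \<bullet> ?t \<noteq> 0 \<and>
      (covec U W \<bullet> ?t) * (covec U' W' \<bullet> c - 1) + (covec U W \<bullet> c - 1) * (covec U' W' \<bullet> ?t) = 0"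
    by auto
  then show ?thesis
    by (intro projective_reflection_covectors[of "covec U W" _ "covec U' W'"])
      (simp_all add: p(2-) inner_diff_right[of _ c p] on)
qed

section \<open>Orbits from sequences of lines\<close>

text \<open>
  Line \<open>m\<close> carries the segment from impact \<open>m\<close> to impact \<open>m + 1\<close>. It crosses the sides of both
  impacts, which makes the segment run through the domain by convexity; consecutive lines meet in
  the common impact point because \<open>reflects\<close> fixes the points of the side.
\<close>

lemma billiard_orbit_crossings:
  assumes "\<And>m. i m < 3" "\<And>m. i (Suc m) \<noteq> i m"
    and "\<And>m. crosses (U m) (W m) (i m)" "\<And>m. crosses (U m) (W m) (i (Suc m))"
    and refl: "\<And>m. reflects (c (i (Suc m))) (i (Suc m)) (U m) (W m) (U (Suc m)) (W (Suc m))"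
  shows "billiard_orbit 3 tri c (\<lambda>m. crossing (U m) (W m) (i m))"
proof -
  define p where "p m = crossing (U m) (W m) (i m)" for m
  have p_side: "p m \<in> side_interior 3 tri (i m)" for m
    by (simp add: p_def crossing_in_side_interior assms)
  have p_Suc: "p (Suc m) = crossing (U m) (W m) (i (Suc m))" for m
    unfolding p_def by (intro reflects_crossing[OF refl] assms)
  have ne: "p m \<noteq> p (Suc m)" for m
    using side_interior_tri_disjoint p_side assms(1,2) by metis
  have on: "covec (U m) (W m) \<bullet> (p (Suc m) - p m) = 0" for m
    using inner_covec_crossing assms by (simp add: inner_diff_right p_Suc) (simp add: p_def)
  have "projective_reflection (p (Suc m) - p m) (p (Suc (Suc m)) - p (Suc m))
          (tri (Suc j mod 3) - tri j) (c j - p (Suc m))"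
    if "j < 3" "p (Suc m) \<in> side_interior 3 tri j" for m j
  proof -
    have "j = i (Suc m)"
      using side_interior_tri_disjoint[OF that(2) p_side] that assms(1) by auto
    then show ?thesis
      using reflects_projective_reflection[OF refl assms(4,3,1) p_Suc on on] ne by (metis eq_iff_diff_eq_0)
  qed
  then show ?thesis
    unfolding billiard_orbit_def p_def[symmetric]
    using ne p_side assms(1,2) open_segment_in_domain by metis
qed

text \<open>
  The orbits are required to be periodic as sequences, which makes passing to a multiple
  of the period immediate.
\<close>

lemma reflective_multiple:
  assumes "openin (top_of_set (frontier (polygon_domain n v))) U1"
    "openin (top_of_set (frontier (polygon_domain n v))) U2" "U1 \<noteq> {}" "U2 \<noteq> {}"
    and orb: "\<And>q1 q2. q1 \<in> U1 \<Longrightarrow> q2 \<in> U2 \<Longrightarrow>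
      \<exists>r. billiard_orbit n v c r \<and> (\<forall>m. r (m + d) = r m) \<and> r 0 = q1 \<and> r 1 = q2"
    and "d dvd k"
  shows "reflective n v c k"
proof -
  have per: "periodic_orbit n v c k r" if "billiard_orbit n v c r" "\<forall>m. r (m + d) = r m" for r
  proof -
    have "r (m + d * e) = r m" for m e
      by (induction e) (use that(2) in \<open>auto simp: algebra_simps\<close>, metis add.assoc add.commute)
    then have "r (m + k) = r m" for m
      using \<open>d dvd k\<close> by (auto simp: dvd_def)
    from this[of 0] this[of 1] show ?thesis
      using that(1) by (auto simp: periodic_orbit_def intro: exI[of _ 1])
  qed
  have "\<exists>r. periodic_orbit n v c k r \<and> r 0 = q1 \<and> r 1 = q2" if "q1 \<in> U1" "q2 \<in> U2" for q1 q2
    using orb[OF that] per by blast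
  moreover obtain q1 q2 where "q1 \<in> U1" "q2 \<in> U2" using assms(3,4) by auto
  ultimately show ?thesis
    unfolding reflective_def using assms(1,2) by metis
qed


section \<open>Period four: two commuting reflections\<close>

definition bouncing_centre :: "nat \<Rightarrow> real^2" where
  "bouncing_centre i = (if i = 0 then vector [0, 1/2] else if i = 1 then 0 else vector [1/2, 0])"

lemma projective_billiard_tri:
  assumes "c 0 $ 2 \<noteq> 0" "c 1 = 0" "c 2 $ 1 \<noteq> 0"
  shows "projective_billiard 3 tri c"
  unfolding projective_billiard_def
proof (intro conjI allI impI simple_polygon_tri)
  fix i :: nat assume i: "i < 3"
  have "bary i (c i) \<noteq> 0"
    using less_3_cases[OF i] assms by (elim disjE) (auto simp: bary_def)
  then show "c i \<notin> side_line 3 tri i"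
    using side_line_tri[OF i] by auto
qed

text \<open>
  The coordinates run through \<open>(U, W)\<close>, \<open>(2 - U, W)\<close>, \<open>(2 - U, 2 - W)\<close>, \<open>(U, 2 - W)\<close>. They stay
  positive, so every one of these lines crosses both legs.
\<close>

lemma bouncing_orbit:
  assumes U: "0 < U" "U < 2" and W: "0 < W" "W < 2"
  shows "\<exists>r. billiard_orbit 3 tri bouncing_centre r \<and> (\<forall>m. r (m + 4) = r m) \<and>
    r 0 = crossing U W 0 \<and> r 1 = crossing U W 2"
proof -
  define i where "i m = (if even m then 0 else 2 :: nat)" for m :: nat
  define X where "X m = (if m mod 4 \<in> {0, 3} then U else 2 - U)" for m :: nat
  define Y where "Y m = (if m mod 4 \<in> {0, 1} then W else 2 - W)" for m :: nat
  have pos: "0 < X m" "0 < Y m" for m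
    using U W by (auto simp: X_def Y_def)
  have "billiard_orbit 3 tri bouncing_centre (\<lambda>m. crossing (X m) (Y m) (i m))"
  proof (rule billiard_orbit_crossings)
    fix m :: nat
    have ev: "even m \<longleftrightarrow> m mod 4 = 0 \<or> m mod 4 = 2" by presburger
    have "m mod 4 < 4" by simp
    then consider "m mod 4 = 0" | "m mod 4 = 1" | "m mod 4 = 2" | "m mod 4 = 3" by linarith
    then show "reflects (bouncing_centre (i (Suc m))) (i (Suc m)) (X m) (Y m) (X (Suc m)) (Y (Suc m))"
      by cases (simp_all add: reflects_def bouncing_centre_def i_def X_def Y_def ev mod_Suc inner_covec field_simps)
  qed (auto simp: i_def crosses_def pos)
  moreover have "crossing (X (m + 4)) (Y (m + 4)) (i (m + 4)) = crossing (X m) (Y m) (i m)" for m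
    by (simp add: X_def Y_def i_def)
  moreover have "crossing (X 0) (Y 0) (i 0) = crossing U W 0"
    "crossing (X 1) (Y 1) (i 1) = crossing U W 2"
    by (simp_all add: X_def Y_def i_def crossing_def)
  ultimately show ?thesis by blast
qed

lemma reflective_bouncing:
  assumes "4 dvd k"
  shows "reflective 3 tri bouncing_centre k"
proof (rule reflective_multiple[OF _ _ _ _ _ assms])
  \<comment> \<open>A leg point at distance \<open>1 / (1 + U)\<close> from the origin has \<open>U < 2\<close> iff the distance exceeds \<open>1/3\<close>.\<close>
  let ?U1 = "side_interior 3 tri 0 \<inter> {x. 1/3 < x $ 1}"
  let ?U2 = "side_interior 3 tri 2 \<inter> {x. 1/3 < x $ 2}"
  show "openin (top_of_set (frontier (polygon_domain 3 tri))) ?U1"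
    "openin (top_of_set (frontier (polygon_domain 3 tri))) ?U2"
    by (intro openin_Int_open side_interior_openin open_Collect_less continuous_intros; simp)+
  have "vector [1/2, 0] \<in> ?U1" "vector [0, 1/2] \<in> ?U2"
    by (simp_all add: side_interior_tri all_less_3 bary_def)
  then show "?U1 \<noteq> {}" "?U2 \<noteq> {}" by blast+
  fix q1 q2 assume q: "q1 \<in> ?U1" "q2 \<in> ?U2"
  \<comment> \<open>The coordinates of the line through \<open>q1\<close> and \<open>q2\<close>.\<close>
  define U W where "U = 1 / q1 $ 1 - 1" and "W = 1 / q2 $ 2 - 1"
  have q': "1/3 < q1 $ 1" "q1 $ 1 < 1" "q1 $ 2 = 0" "1/3 < q2 $ 2" "q2 $ 2 < 1" "q2 $ 1 = 0"
    using q by (auto simp: side_interior_tri all_less_3 bary_def)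
  then have "0 < U" "U < 2" "0 < W" "W < 2"
    by (auto simp: U_def W_def field_simps)
  moreover have "q1 = crossing U W 0" "q2 = crossing U W 2"
    using q' by (auto simp: crossing_def U_def W_def vec2_eq_iff)
  ultimately show "\<exists>r. billiard_orbit 3 tri bouncing_centre r \<and> (\<forall>m. r (m + 4) = r m) \<and> r 0 = q1 \<and> r 1 = q2"
    using bouncing_orbit by metis
qed

section \<open>Odd periods: a finite rotation and a central reflection\<close>

text \<open>
  The centre of a leg is the point of the hypotenuse line for which the reflection at the leg is
  \<open>W' = 2 cos \<theta> U - W\<close>, respectively \<open>U' = 2 cos \<theta> W - U\<close>. The product of
  these two linear maps has determinant 1 and trace \<open>2 cos (2 \<theta>)\<close>, so it is conjugate to a
  rotation by \<open>2 \<theta>\<close>.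
\<close>

definition rotating_centre :: "real \<Rightarrow> nat \<Rightarrow> real^2" where
  "rotating_centre \<theta> i =
     (if i = 0 then vector [- cos \<theta> / (1 - cos \<theta>), 1 / (1 - cos \<theta>)] else if i = 1 then 0
      else vector [1 / (1 - cos \<theta>), - cos \<theta> / (1 - cos \<theta>)])"

text \<open>
  The solution of the recurrence \<open>y (r + 2) = 2 cos \<theta> y (r + 1) - y r\<close> with initial values
  \<open>a\<close> and \<open>b\<close>, provided that \<open>sin \<theta> \<noteq> 0\<close>.
\<close>

definition sine_seq :: "real \<Rightarrow> real \<Rightarrow> real \<Rightarrow> nat \<Rightarrow> real" where
  "sine_seq \<theta> a b r = (b * sin (real r * \<theta>) - a * sin ((real r - 1) * \<theta>)) / sin \<theta>"

lemma sine_seq_0_1: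
  assumes "sin \<theta> \<noteq> 0"
  shows "sine_seq \<theta> a b 0 = a" "sine_seq \<theta> a b (Suc 0) = b"
  using assms by (simp_all add: sine_seq_def)

lemma sine_seq_rec:
  "sine_seq \<theta> a b r + sine_seq \<theta> a b (Suc (Suc r)) = 2 * cos \<theta> * sine_seq \<theta> a b (Suc r)"
proof -
  have up: "sin ((real r + 2) * \<theta>) = 2 * cos \<theta> * sin ((real r + 1) * \<theta>) - sin (real r * \<theta>)"
    using sin_add[of "(real r + 1) * \<theta>" \<theta>] sin_diff[of "(real r + 1) * \<theta>" \<theta>]
    by (simp add: algebra_simps)
  have down: "sin ((real r - 1) * \<theta>) = 2 * cos \<theta> * sin (real r * \<theta>) - sin ((real r + 1) * \<theta>)"
    using sin_add[of "real r * \<theta>" \<theta>] sin_diff[of "real r * \<theta>" \<theta>]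
    by (simp add: algebra_simps)
  have "b * sin (real r * \<theta>) - a * sin ((real r - 1) * \<theta>) +
      (b * sin ((real r + 2) * \<theta>) - a * sin ((real r + 1) * \<theta>)) =
      2 * cos \<theta> * (b * sin ((real r + 1) * \<theta>) - a * sin (real r * \<theta>))"
    unfolding up down by (simp add: algebra_simps)
  then show ?thesis
    by (simp add: sine_seq_def add_divide_distrib[symmetric] add.commute)
qed

lemma sin_cos_pi_divide:
  assumes "\<theta> = pi / real N" "2 \<le> N"
  shows "0 < sin \<theta>" "cos \<theta> < 1"
proof -
  show "0 < sin \<theta>"
    using sin_pi_divide_n_gt_0 assms by simp
  then show "cos \<theta> < 1"
    using cos_one_sin_zero[of \<theta>] cos_le_one[of \<theta>] by linarith
qed

lemma sine_seq_period:
  assumes "\<theta> = pi / real N" "2 \<le> N"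
  shows "sine_seq \<theta> a b N = - a" "sine_seq \<theta> a b (Suc N) = - b"
proof -
  have "real N * \<theta> = pi" "sin \<theta> > 0"
    using sin_cos_pi_divide(1) assms by auto
  then show "sine_seq \<theta> a b N = - a" "sine_seq \<theta> a b (Suc N) = - b"
    by (simp_all add: sine_seq_def algebra_simps)
qed

text \<open>
  For \<open>a < 0 < b\<close> both terms of the numerator are nonnegative as long as the angles stay in
  \<open>[0, \<pi>]\<close>, and the first is positive before the last step; at the last step the value is \<open>- a\<close>.
\<close>

lemma sine_seq_pos:
  assumes "\<theta> = pi / real N" "2 \<le> N" "a < 0" "0 < b" "1 \<le> r" "r \<le> N"
  shows "0 < sine_seq \<theta> a b r"
proof (cases "r = N")
  case True
  then show ?thesis using sine_seq_period(1)[OF assms(1,2)] assms(3) by simp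
next
  case False
  have "0 < sin \<theta>"
    using sin_cos_pi_divide(1) assms(1,2) by blast
  moreover have \<theta>: "0 < \<theta>" "real N * \<theta> = pi"
    using assms by auto
  have "real r * \<theta> < real N * \<theta>" "(real r - 1) * \<theta> \<le> real N * \<theta>"
    using \<theta>(1) assms(6) False by (auto intro!: mult_strict_right_mono mult_right_mono)
  then have "0 < sin (real r * \<theta>)" "0 \<le> sin ((real r - 1) * \<theta>)"
    using \<theta> assms(5) by (auto intro!: sin_gt_zero sin_ge_zero)
  ultimately show ?thesis
    using assms(3,4) unfolding sine_seq_def
    by (intro divide_pos_pos) (smt (verit) mult_pos_pos mult_nonpos_nonneg)+
qed

text \<open>
  One period starts on the hypotenuse with \<open>W = y 0 < 0\<close> and \<open>U = y 1 > 0\<close>. Impact \<open>r\<close>, for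
  \<open>1 \<le> r \<le> N\<close>, is on a leg and is determined by \<open>y r > 0\<close>; the line that leaves it has the
  coordinates \<open>y r\<close> and \<open>y (r + 1)\<close>. Evenness of \<open>N\<close> makes the last leg the one on the second axis,
  so that \<open>y N = - W\<close> and \<open>y (N + 1) = - U\<close> end up in the places of \<open>W\<close> and \<open>U\<close>. The
  reflection at the hypotenuse changes both signs and closes the orbit.
\<close>

lemma rotating_orbit:
  assumes N: "even N" "2 \<le> N" "\<theta> = pi / real N" and "0 < U" "W < 0"
  shows "\<exists>r. billiard_orbit 3 tri (rotating_centre \<theta>) r \<and> (\<forall>m. r (m + Suc N) = r m) \<and>
    r 0 = crossing U W 1 \<and> r 1 = crossing U W 0"
proof -
  define y where "y = sine_seq \<theta> W U"
  have s: "0 < sin \<theta>" and c: "cos \<theta> < 1"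
    using sin_cos_pi_divide N(2,3) by blast+
  have y01: "y 0 = W" "y (Suc 0) = U"
    using sine_seq_0_1 s by (auto simp: y_def)
  have rec: "y r + y (Suc (Suc r)) = 2 * cos \<theta> * y (Suc r)" for r
    unfolding y_def by (rule sine_seq_rec)
  have per: "y N = - W" "y (Suc N) = - U"
    unfolding y_def using sine_seq_period N by auto
  have pos: "0 < y r" if "1 \<le> r" "r \<le> N" for r
    unfolding y_def using sine_seq_pos that N assms by auto
  define j where "j r = (if r = 0 then 1 else if odd r then 0 else 2 :: nat)" for r :: nat
  \<comment> \<open>Odd impacts lie on the leg that determines \<open>U\<close>, even ones with \<open>r > 0\<close> on the leg that
    determines \<open>W\<close>; at \<open>r = 0\<close> the even rule gives the initial coordinates \<open>y 1\<close> and \<open>y 0\<close>.\<close>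
  define A where "A r = (if odd r then y r else y (Suc r))" for r
  define B where "B r = (if odd r then y (Suc r) else y r)" for r
  define \<rho> where "\<rho> m = m mod Suc N" for m
  have \<rho>: "\<rho> m \<le> N" "\<rho> (Suc m) = (if \<rho> m = N then 0 else Suc (\<rho> m))" for m
    using mod_less_divisor[of "Suc N" m] by (auto simp: \<rho>_def mod_Suc simp del: mod_less_divisor)
  have "billiard_orbit 3 tri (rotating_centre \<theta>) (\<lambda>m. crossing (A (\<rho> m)) (B (\<rho> m)) (j (\<rho> m)))"
  proof (rule billiard_orbit_crossings)
    fix m
    show "j (\<rho> m) < 3" by (simp add: j_def)
    show "j (\<rho> (Suc m)) \<noteq> j (\<rho> m)"
      using N by (auto simp: j_def \<rho>)
    show "crosses (A (\<rho> m)) (B (\<rho> m)) (j (\<rho> m))"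
      using pos[of "\<rho> m"] \<rho>(1)[of m] assms(4,5) y01
      by (auto simp: crosses_def j_def A_def B_def mult_less_0_iff)
    show "crosses (A (\<rho> m)) (B (\<rho> m)) (j (\<rho> (Suc m)))"
      using pos[of "Suc (\<rho> m)"] \<rho>[of m] N assms(4,5) per
      by (auto simp: crosses_def j_def A_def B_def mult_less_0_iff)
    show "reflects (rotating_centre \<theta> (j (\<rho> (Suc m)))) (j (\<rho> (Suc m)))
        (A (\<rho> m)) (B (\<rho> m)) (A (\<rho> (Suc m))) (B (\<rho> (Suc m)))"
    proof (cases "\<rho> m = N")
      case True
      then show ?thesis
        using N y01 per by (simp add: \<rho> j_def A_def B_def reflects_def rotating_centre_def)
    next
      case False
      then show ?thesis
        using rec[of "\<rho> m"] c
        by (simp add: \<rho> j_def A_def B_def reflects_def rotating_centre_def inner_covec)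
          (simp add: divide_simps, simp add: algebra_simps)
    qed
  qed
  moreover have "\<rho> (m + Suc N) = \<rho> m" for m
    unfolding \<rho>_def by (rule mod_add_self2)
  moreover have "crossing (A (\<rho> 0)) (B (\<rho> 0)) (j (\<rho> 0)) = crossing U W 1"
    "crossing (A (\<rho> 1)) (B (\<rho> 1)) (j (\<rho> 1)) = crossing U W 0"
    using N y01 by (simp_all add: \<rho>_def j_def A_def B_def crossing_def)
  ultimately show ?thesis
    by (intro exI[of _ "\<lambda>m. crossing (A (\<rho> m)) (B (\<rho> m)) (j (\<rho> m))"]) simp
qed

lemma reflective_rotating:
  assumes "even N" "2 \<le> N" "\<theta> = pi / real N" "Suc N dvd k"
  shows "reflective 3 tri (rotating_centre \<theta>) k"
proof (rule reflective_multiple[OF _ _ _ _ _ assms(4)])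
  show "openin (top_of_set (frontier (polygon_domain 3 tri))) (side_interior 3 tri 1)"
    "openin (top_of_set (frontier (polygon_domain 3 tri))) (side_interior 3 tri 0)"
    by (simp_all add: side_interior_openin)
  have "vector [1/2, 1/2] \<in> side_interior 3 tri 1" "vector [1/2, 0] \<in> side_interior 3 tri 0"
    by (simp_all add: side_interior_tri all_less_3 bary_def)
  then show "side_interior 3 tri 1 \<noteq> {}" "side_interior 3 tri 0 \<noteq> {}" by blast+
  fix q1 q2 assume q: "q1 \<in> side_interior 3 tri 1" "q2 \<in> side_interior 3 tri 0"
  \<comment> \<open>The coordinates of the line through \<open>q1\<close> and \<open>q2\<close>.\<close>
  define U W where "U = 1 / q2 $ 1 - 1" and "W = - U * q1 $ 1 / q1 $ 2"
  have q': "0 < q1 $ 1" "0 < q1 $ 2" "q1 $ 1 + q1 $ 2 = 1" "0 < q2 $ 1" "q2 $ 1 < 1" "q2 $ 2 = 0"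
    using q by (auto simp: side_interior_tri all_less_3 bary_def)
  then have UW: "0 < U" "W < 0"
    by (auto simp: U_def W_def field_simps)
  have x: "q1 $ 1 = 1 - q1 $ 2"
    using q'(3) by linarith
  have "W - U = - U / q1 $ 2"
    unfolding W_def x using q'(2) by (simp add: diff_divide_distrib right_diff_distrib)
  then have "W / (W - U) = q1 $ 1" "- U / (W - U) = q1 $ 2"
    using q'(2) UW(1) by (simp_all add: W_def)
  then have "q1 = crossing U W 1"
    by (simp add: crossing_def vec2_eq_iff)
  moreover have "q2 = crossing U W 0"
    using q' by (auto simp: crossing_def U_def vec2_eq_iff)
  ultimately show "\<exists>r. billiard_orbit 3 tri (rotating_centre \<theta>) r \<and> (\<forall>m. r (m + Suc N) = r m) \<and>
      r 0 = q1 \<and> r 1 = q2"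
    using rotating_orbit[OF assms(1-3) UW] by metis
qed

lemma dvd_4_or_odd_divisor:
  fixes k :: nat
  assumes "3 \<le> k"
  shows "4 dvd k \<or> (\<exists>N. even N \<and> 2 \<le> N \<and> Suc N dvd k)"
proof (cases "4 dvd k")
  case False
  define d where "d = (if odd k then k else k div 2)"
  have "odd d" "3 \<le> d" "d dvd k"
    using False assms by (auto simp: d_def) presburger+
  then have "even (d - 1)" "2 \<le> d - 1" "Suc (d - 1) dvd k" by auto
  then show ?thesis by blast
qed simp

theorem corollary4p7:
  "(\<forall>k::nat. k \<ge> 3 \<longrightarrow> (\<exists>n v c. projective_billiard n v c \<and> reflective n v c k)) \<and>
   (\<forall>k::nat. odd k \<and> k \<ge> 5 \<longrightarrow> (\<exists>n v c. projective_billiard n v c \<and> reflective n v c k))"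
proof -
  have "\<exists>n v c. projective_billiard n v c \<and> reflective n v c k" if "3 \<le> k" for k :: nat
    using dvd_4_or_odd_divisor[OF that]
  proof
    assume "4 dvd k"
    moreover have "projective_billiard 3 tri bouncing_centre"
      by (rule projective_billiard_tri) (simp_all add: bouncing_centre_def)
    ultimately show ?thesis using reflective_bouncing by blast
  next
    assume "\<exists>N. even N \<and> 2 \<le> N \<and> Suc N dvd k"
    then obtain N where N: "even N" "2 \<le> N" "Suc N dvd k" by blast
    define \<theta> where "\<theta> = pi / real N"
    have "cos \<theta> < 1"
      using sin_cos_pi_divide(2)[OF \<theta>_def N(2)] .
    then have "projective_billiard 3 tri (rotating_centre \<theta>)"
      by (intro projective_billiard_tri) (simp_all add: rotating_centre_def)
    then show ?thesis using reflective_rotating[OF N(1,2) \<theta>_def N(3)] by blast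
  qed
  then show ?thesis by simp
qed

end
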